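(* Let $0<\alpha<1$ and let $m\ge 1$ be an integer. Let $H_1,\dots,H_m$ be calibration documents, $X$ a test document, $M_\pi(H_i)$ the complete-path maxima of the calibration documents and $M_{\pi,t}(X)$ the partial-path maximum of the test document after its $t$-th executed action, and let $$p_t^{\mathrm{path}}(X)=\frac{1+\sum_{i=1}^m\mathbf 1\{M_\pi(H_i)\ge M_{\pi,t}(X)\}}{m+1}.$$ Suppose the procedure rejects (raises an alert) exactly when $p_t^{\mathrm{path}}(X)\le\alpha$ for some executed action $t\geq 1$. Then rejection requires $$m\ge\left\lceil\frac1\alpha\right\rceil-1 .$$
   Context: A route generator $\pi$ assigns to each document $x$ a finite sequence of actions $a_1(x),\dots,a_{T_\pi(x)}(x)$ (each a choice of document prefix and detector, possibly depending on earlier scores). Each action $a$ has an extended-real score map $S_a$ and an extended-real transformation $g_a$. The complete-path maximum is $M_\pi(x)=\max_{1\le t\le T_\pi(x)}g_{a_t(x)}\{S_{a_t(x)}(x)\}$ (equal to $-\infty$ for an empty route), and the partial-path maximum is $M_{\pi,t}(x)=\max_{1\le s\le t}g_{a_s(x)}\{S_{a_s(x)}(x)\}$ for $1\le t\le T_\pi(x)$. Deployment on the test document $X$ executes an initial segment of its route. *)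

theory Defs
  imports Complex_Main "HOL-Library.Extended_Real"
begin

text \<open>
  A route generator sends a document to the finite list of actions of its complete route.  Actions
  are elements of an arbitrary type \<open>'a\<close> (standing for pairs of document prefix and detector); an
  action may depend on the scores seen earlier on the route, since those scores are functions of
  the document.
\<close>

type_synonym ('x, 'a) route_generator = "'x \<Rightarrow> 'a list"

definition route_length :: "('x, 'a) route_generator \<Rightarrow> 'x \<Rightarrow> nat" where
  "route_length \<pi> x = length (\<pi> x)"

text \<open>Actions are counted from 1; only indices between 1 and the route length are meaningful.\<close>

definition route_action :: "('x, 'a) route_generator \<Rightarrow> 'x \<Rightarrow> nat \<Rightarrow> 'a" where
  "route_action \<pi> x t = \<pi> x ! (t - 1)"

definition transformed_score ::
    "('x, 'a) route_generator \<Rightarrow> ('a \<Rightarrow> 'x \<Rightarrow> ereal) \<Rightarrow> ('a \<Rightarrow> ereal \<Rightarrow> ereal) \<Rightarrow> 'x \<Rightarrow> nat \<Rightarrow> ereal" where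
  "transformed_score \<pi> S g x t = g (route_action \<pi> x t) (S (route_action \<pi> x t) x)"

definition complete_path_max ::
    "('x, 'a) route_generator \<Rightarrow> ('a \<Rightarrow> 'x \<Rightarrow> ereal) \<Rightarrow> ('a \<Rightarrow> ereal \<Rightarrow> ereal) \<Rightarrow> 'x \<Rightarrow> ereal" where
  "complete_path_max \<pi> S g x =
     (if route_length \<pi> x = 0 then - \<infinity>
      else Max (transformed_score \<pi> S g x ` {1..route_length \<pi> x}))"

text \<open>Meaningful only for \<open>1 \<le> t \<le> route_length \<pi> x\<close>.\<close>

definition partial_path_max ::
    "('x, 'a) route_generator \<Rightarrow> ('a \<Rightarrow> 'x \<Rightarrow> ereal) \<Rightarrow> ('a \<Rightarrow> ereal \<Rightarrow> ereal) \<Rightarrow> 'x \<Rightarrow> nat \<Rightarrow> ereal" where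
  "partial_path_max \<pi> S g x t = Max (transformed_score \<pi> S g x ` {1..t})"

definition path_p_value ::
    "('x, 'a) route_generator \<Rightarrow> ('a \<Rightarrow> 'x \<Rightarrow> ereal) \<Rightarrow> ('a \<Rightarrow> ereal \<Rightarrow> ereal) \<Rightarrow>
     nat \<Rightarrow> (nat \<Rightarrow> 'x) \<Rightarrow> 'x \<Rightarrow> nat \<Rightarrow> real" where
  "path_p_value \<pi> S g m H X t =
     (1 + (\<Sum>i = 1..m. of_bool (complete_path_max \<pi> S g (H i) \<ge> partial_path_max \<pi> S g X t)))
       / (real m + 1)"

end

theory Submission imports Defs begin

text \<open>The added 1 in the numerator gives the p-value a floor: the indicator sum is
  nonnegative, so whatever the scores, the value is at least 1/(m+1)
  (\<open>path_p_value_ge\<close>). An alert therefore forces 1/(m+1) \<le> \<alpha>, that is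
  1/\<alpha> \<le> m+1, and since m+1 is an integer the left side may be rounded up.\<close>

lemma path_p_value_ge: "path_p_value \<pi> S g m H X t \<ge> 1 / (real m + 1)"
  unfolding path_p_value_def by (intro divide_right_mono) (simp_all add: sum_nonneg)

theorem corollary5p3:
  fixes \<pi> :: "('x, 'a) route_generator"
    and S :: "'a \<Rightarrow> 'x \<Rightarrow> ereal"
    and g :: "'a \<Rightarrow> ereal \<Rightarrow> ereal"
    and \<alpha> :: real
    and m n :: nat
    and H :: "nat \<Rightarrow> 'x"
    and X :: 'x
    and rejects :: bool
  assumes "0 < \<alpha>" and "\<alpha> < 1"
    and "m \<ge> 1"
    and executed: "n \<le> route_length \<pi> X"
    and rejects_iff: "rejects \<longleftrightarrow> (\<exists>t\<in>{1..n}. path_p_value \<pi> S g m H X t \<le> \<alpha>)"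
  shows "rejects \<longrightarrow> int m \<ge> \<lceil>1 / \<alpha>\<rceil> - 1"
proof
  assume rejects
  then obtain t where "path_p_value \<pi> S g m H X t \<le> \<alpha>"
    using rejects_iff by blast
  \<comment> \<open>The floor is uniform in \<open>t\<close>, so every alerting action yields the
    same bound.\<close>
  then have "1 / (real m + 1) \<le> \<alpha>"
    by (rule order_trans[OF path_p_value_ge])
  \<comment> \<open>Writing the bound as a cast integer puts it in the form
    \<open>ceiling_le\<close> expects.\<close>
  then have "1 / \<alpha> \<le> of_int (int m + 1)"
    using \<open>0 < \<alpha>\<close> by (simp add: field_simps)
  then have "\<lceil>1 / \<alpha>\<rceil> \<le> int m + 1"
    by (rule ceiling_le)
  then show "int m \<ge> \<lceil>1 / \<alpha>\<rceil> - 1"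
    by simp
qed

end
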